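(* There is a constant $c>0$ such that for every integer $n\ge 1$ and every invertible $n\times n$ matrix $A$ with complex entries, if $a_1,\dots,a_n\in\mathbb{C}^n$ are the columns of $A$ and $b_1,\dots,b_n$ are the rows of $A^{-1}$, then $$\log n\le c\,\max_{1\le k\le n}\left\Vert b_k\right\Vert\,\max_{1\le k\le n}\left\Vert\sum_{j=1}^{k}a_j\right\Vert .$$
   Context: The norm $\|\cdot\|$ is the finite-dimensional $\ell^2$ (Euclidean) norm on $\mathbb{C}^n$. The constant $c$ does not depend on $n$ or $A$. *)

theory Defs
  imports "HOL-Analysis.L2_Norm" "Jordan_Normal_Form.Gauss_Jordan_Elimination"
begin

definition l2_norm_vec :: "complex Matrix.vec \<Rightarrow> real" where
  "l2_norm_vec v = L2_set (\<lambda>i. cmod (vec_index v i)) {..<dim_vec v}"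

text \<open>On invertible matrices, the library's partial inverse \<^const>\<open>mat_inverse\<close> is defined and is
  the two-sided inverse.\<close>

lemma the_mat_inverse:
  fixes A :: "'a::field mat"
  assumes A: "A \<in> carrier_mat n n" and inv: "invertible_mat A"
  shows "the (mat_inverse A) \<in> carrier_mat n n"
    and "inverts_mat A (the (mat_inverse A))"
    and "inverts_mat (the (mat_inverse A)) A"
proof -
  obtain B where AB: "A * B = 1\<^sub>m n" and BA: "B * A = 1\<^sub>m (dim_row B)"
    using inv A unfolding invertible_mat_def inverts_mat_def by auto
  have "dim_col B = n" using arg_cong[OF AB, of dim_col] by simp
  moreover have "dim_row B = n" using arg_cong[OF BA, of dim_col] A by simp
  ultimately have B: "B \<in> carrier_mat n n" by auto
  have "A \<in> Units (ring_mat TYPE('a) n ())"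
    using A B AB BA by (auto simp: Units_def ring_mat_def)
  with mat_inverse(1)[OF A, where b = "()"] obtain C where C: "mat_inverse A = Some C" by blast
  show "the (mat_inverse A) \<in> carrier_mat n n"
    and "inverts_mat A (the (mat_inverse A))"
    and "inverts_mat (the (mat_inverse A)) A"
    using mat_inverse(2)[OF A C] A C by (auto simp: inverts_mat_def)
qed

end

theory Submission
  imports Defs "HOL-Analysis.Harmonic_Numbers" "HOL-Analysis.Henstock_Kurzweil_Integration"
begin

text \<open>
  Let \<open>B\<close> be the inverse of \<open>A\<close> and \<open>S\<close> the matrix whose columns are the partial sums
  of the columns of \<open>A\<close>. Biorthogonality says that \<open>B S\<close> is the triangular matrix with entry
  \<open>1\<close> at \<open>(i, j)\<close> if \<open>i \<le> j\<close> and \<open>0\<close> otherwise, whatever \<open>A\<close> is. So the theorem is a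
  lower bound for every factorization of the triangular matrix: if the rows of the left factor have
  norm at most \<open>\<beta>\<close> and the columns of the right factor norm at most \<open>\<sigma>\<close>, then
  \<open>\<beta> \<sigma>\<close> grows at least like \<open>ln n\<close> (\<open>harm_le_of_triangular_factorization\<close>).

  The bound comes from pairing with the Hilbert matrix \<open>1 / (j - i)\<close>, which is bounded on
  \<open>l\<^sup>2\<close> while its upper triangular part has entries that sum to \<open>n harm n - n\<close>
  (\<open>sum_inverse_differences\<close>). Its boundedness is used in the form of its Fourier symbol: the numbers
  \<open>2 pi / d\<close> are the sine coefficients of the sawtooth \<open>pi - t\<close> on \<open>[0, 2 pi]\<close>
  (\<open>has_integral_sawtooth_sin\<close>), which is bounded by \<open>pi\<close>. Thus the pairing is the integral of the
  sawtooth against the product of two vector-valued trigonometric polynomials, one with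
  coefficients the rows of \<open>B\<close> and one with the columns of \<open>S\<close>, and Parseval's
  identity (\<open>has_integral_norm_power2_trig_poly\<close>) gives \<open>harm n - 1 \<le> pi \<beta> \<sigma>\<close>.
  The additive constant is absorbed by \<open>1 \<le> \<beta> \<sigma>\<close>, which is the Cauchy-Schwarz inequality for a
  diagonal entry of \<open>B S\<close>. The resulting constant is \<open>1 + pi\<close>.
\<close>

unbundle no vec_syntax and no inner_syntax

lemma has_integral_sawtooth_sin:
  fixes d :: nat
  assumes "d > 0"
  shows "((\<lambda>t. (pi - t) * sin (real d * t)) has_integral 2 * pi / real d) {0..2*pi}"
proof -
  define e where "e = 1 / real d"
  have ed: "e * real d = 1" using assms by (simp add: e_def)
  define G where "G t = e * ((t - pi) * cos (real d * t)) - e * e * sin (real d * t)" for t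
  have "((\<lambda>t. (pi - t) * sin (real d * t)) has_integral (G (2*pi) - G 0)) {0..2*pi}"
  proof (rule fundamental_theorem_of_calculus)
    fix t
    have "(G has_real_derivative
        e * (cos (real d * t) - (t - pi) * sin (real d * t) * real d)
          - e * e * (cos (real d * t) * real d)) (at t within {0..2*pi})"
      unfolding G_def by (auto intro!: derivative_eq_intros)
    also have "e * (cos (real d * t) - (t - pi) * sin (real d * t) * real d)
          - e * e * (cos (real d * t) * real d)
        = e * cos (real d * t) - (e * real d) * ((t - pi) * sin (real d * t))
          - (e * real d) * (e * cos (real d * t))"
      by (simp add: algebra_simps)
    also have "\<dots> = (pi - t) * sin (real d * t)"
      unfolding ed by (simp add: algebra_simps)
    finally show "(G has_vector_derivative (pi - t) * sin (real d * t)) (at t within {0..2*pi})"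
      by (simp add: has_real_derivative_iff_has_vector_derivative)
  qed simp
  moreover have "cos (real d * (2 * pi)) = 1" "sin (real d * (2 * pi)) = 0"
    using cos_int_2pin[of "int d"] sin_int_2pin[of "int d"] by (simp_all add: mult_ac)
  then have "G (2*pi) - G 0 = 2 * pi / real d"
    by (simp add: G_def e_def field_simps)
  ultimately show ?thesis by simp
qed

lemma has_integral_cis:
  fixes m :: int
  shows "((\<lambda>t. cis (of_int m * t)) has_integral (if m = 0 then of_real (2 * pi) else 0)) {0..2*pi}"
proof (cases "m = 0")
  case True
  then show ?thesis using has_integral_const_real[of "1::complex" 0 "2*pi"]
    by (simp add: scaleR_conv_of_real)
next
  case False
  define G where "G t = cis (of_int m * t) / (\<i> * of_int m)" for t
  have "((\<lambda>t. cis (of_int m * t)) has_integral (G (2*pi) - G 0)) {0..2*pi}"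
  proof (rule fundamental_theorem_of_calculus)
    fix t
    show "(G has_vector_derivative cis (of_int m * t)) (at t within {0..2*pi})"
      unfolding G_def cis_conv_exp using False
      by (auto intro!: derivative_eq_intros has_vector_derivative_real_field simp: field_simps)
  qed simp
  moreover have "cis (of_int m * (2 * pi)) = 1"
    using cis_multiple_2pi[of "of_int m"] by (simp add: mult_ac)
  then have "G (2*pi) - G 0 = 0"
    by (simp add: G_def)
  ultimately show ?thesis using False by simp
qed

text \<open>Parseval's identity for trigonometric polynomials. Allowing any injective family of
  integer frequencies lets one polynomial below run over \<open>- i\<close> and the other over \<open>j\<close>.\<close>

lemma has_integral_norm_power2_trig_poly:
  fixes c :: "'a \<Rightarrow> complex" and k :: "'a \<Rightarrow> int"
  assumes "finite I" "inj_on k I"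
  shows "((\<lambda>t. (cmod (\<Sum>i\<in>I. c i * cis (of_int (k i) * t)))\<^sup>2) has_integral
           2 * pi * (\<Sum>i\<in>I. (cmod (c i))\<^sup>2)) {0..2*pi}"
proof -
  have expand: "complex_of_real ((cmod (\<Sum>i\<in>I. c i * cis (of_int (k i) * t)))\<^sup>2) =
      (\<Sum>i\<in>I. \<Sum>j\<in>I. c i * cnj (c j) * cis (of_int (k i - k j) * t))" for t
  proof -
    have "cis (of_int (k i - k j) * t) = cis (of_int (k i) * t) * cnj (cis (of_int (k j) * t))"
      for i j by (simp add: cis_cnj cis_mult algebra_simps)
    then show ?thesis
      unfolding complex_norm_square cnj_sum sum_product
      by (simp only: complex_cnj_mult mult_ac)
  qed
  have "((\<lambda>t. \<Sum>i\<in>I. \<Sum>j\<in>I. c i * cnj (c j) * cis (of_int (k i - k j) * t)) has_integral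
      (\<Sum>i\<in>I. \<Sum>j\<in>I. c i * cnj (c j) * (if k i - k j = 0 then of_real (2 * pi) else 0))) {0..2*pi}"
    using assms(1) by (intro has_integral_sum has_integral_mult_right has_integral_cis)
  also have "(\<Sum>i\<in>I. \<Sum>j\<in>I. c i * cnj (c j) * (if k i - k j = 0 then of_real (2 * pi) else 0))
      = (\<Sum>i\<in>I. \<Sum>j\<in>I. if i = j then c i * cnj (c j) * of_real (2 * pi) else 0)"
    using assms(2) by (intro sum.cong refl) (auto simp: inj_on_def)
  also have "\<dots> = (\<Sum>i\<in>I. c i * cnj (c i) * of_real (2 * pi))"
    using assms(1) by simp
  also have "\<dots> = (\<Sum>i\<in>I. of_real (2 * pi) * of_real ((cmod (c i))\<^sup>2))"
    by (simp only: complex_norm_square mult_ac)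
  also have "\<dots> = of_real (2 * pi * (\<Sum>i\<in>I. (cmod (c i))\<^sup>2))"
    by (simp add: sum_distrib_left)
  finally have "((\<lambda>t. complex_of_real ((cmod (\<Sum>i\<in>I. c i * cis (of_int (k i) * t)))\<^sup>2))
      has_integral of_real (2 * pi * (\<Sum>i\<in>I. (cmod (c i))\<^sup>2))) {0..2*pi}"
    unfolding expand .
  from has_integral_linear[OF this bounded_linear_Re] show ?thesis
    by (simp only: o_def Re_complex_of_real)
qed

lemma sum_inverse_differences:
  "(\<Sum>i<n. \<Sum>j<n. if i < j then 1 / real (j - i) else 0) = real n * harm n - real n"
proof (induction n)
  case 0
  show ?case by simp
next
  case (Suc n)
  have "(\<Sum>i<n. 1 / real (n - i)) = (\<Sum>i=1..n. 1 / real i)"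
    by (rule sum.reindex_bij_witness[of _ "\<lambda>i. n - i" "\<lambda>i. n - i"]) auto
  then have "(\<Sum>i<n. 1 / real (n - i)) = harm n"
    by (simp add: harm_def inverse_eq_divide)
  moreover have "(\<Sum>j<n. if n < j then 1 / real (j - n) else 0) = 0"
    by (intro sum.neutral) auto
  ultimately have "(\<Sum>i<Suc n. \<Sum>j<Suc n. if i < j then 1 / real (j - i) else 0)
      = (real n * harm n - real n) + harm n"
    using Suc.IH by (simp add: sum.distrib)
  also have "\<dots> = real (Suc n) * harm (Suc n) - real (Suc n)"
    by (simp add: harm_Suc field_simps)
  finally show ?case .
qed

text \<open>A quantitative form of the unboundedness of triangular truncation: it bounds from below the
  \<open>\<gamma>\<^sub>2\<close> norm (the Schur multiplier norm) of the triangular matrix. The sine series of the triangular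
  matrix is the imaginary part of \<open>\<Sum>l. F l t * G l t\<close>, where \<open>F\<close> and \<open>G\<close> are the
  generating polynomials of the two factors. Integrating its product with the sawtooth gives the sum of
  the Hilbert matrix over the triangle, and estimating it pointwise by the squares of \<open>F\<close> and
  \<open>G\<close> reduces the upper bound to Parseval's identity.\<close>

lemma harm_le_of_triangular_factorization:
  fixes b s :: "nat \<Rightarrow> 'a \<Rightarrow> complex" and \<beta> \<sigma> :: real
  assumes "finite L" "n > 0" "\<beta> > 0" "\<sigma> > 0"
    and tri: "\<And>i j. i < n \<Longrightarrow> j < n \<Longrightarrow> (\<Sum>l\<in>L. b i l * s j l) = (if i \<le> j then 1 else 0)"
    and b: "\<And>i. i < n \<Longrightarrow> (\<Sum>l\<in>L. (cmod (b i l))\<^sup>2) \<le> \<beta>\<^sup>2"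
    and s: "\<And>j. j < n \<Longrightarrow> (\<Sum>l\<in>L. (cmod (s j l))\<^sup>2) \<le> \<sigma>\<^sup>2"
  shows "harm n \<le> 1 + pi * \<beta> * \<sigma>"
proof -
  \<comment> \<open>The weight in the arithmetic-geometric mean inequality that balances the two factors, so that
    the bound depends on the product \<open>\<beta> * \<sigma>\<close> only.\<close>
  define r where "r = \<sigma> / \<beta>"
  have r: "r > 0" using assms by (simp add: r_def)
  define F where "F l t = (\<Sum>i<n. b i l * cis (of_int (- int i) * t))" for l t
  define G where "G l t = (\<Sum>j<n. s j l * cis (of_int (int j) * t))" for l t
  define E where "E t = (\<Sum>i<n. \<Sum>j<n. if i < j then (pi - t) * sin (real (j - i) * t) else 0)" for t
  define U where "U t = pi / 2 * (\<Sum>l\<in>L. r * (cmod (F l t))\<^sup>2 + (cmod (G l t))\<^sup>2 / r)" for t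

  have FG: "(\<Sum>l\<in>L. F l t * G l t)
      = (\<Sum>i<n. \<Sum>j<n. if i \<le> j then cis (real (j - i) * t) else 0)" for t
  proof -
    have "(\<Sum>l\<in>L. F l t * G l t) = (\<Sum>l\<in>L. \<Sum>i<n. \<Sum>j<n.
        b i l * s j l * (cis (of_int (- int i) * t) * cis (of_int (int j) * t)))"
      unfolding F_def G_def sum_product by (simp only: mult_ac)
    also have "\<dots> = (\<Sum>i<n. \<Sum>j<n. \<Sum>l\<in>L.
        b i l * s j l * (cis (of_int (- int i) * t) * cis (of_int (int j) * t)))"
      by (subst sum.swap, intro sum.cong refl, rule sum.swap)
    also have "\<dots> = (\<Sum>i<n. \<Sum>j<n. (\<Sum>l\<in>L. b i l * s j l) *
         (cis (of_int (- int i) * t) * cis (of_int (int j) * t)))"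
      by (simp only: sum_distrib_right)
    also have "\<dots> = (\<Sum>i<n. \<Sum>j<n. if i \<le> j then cis (real (j - i) * t) else 0)"
      by (intro sum.cong refl) (auto simp: tri cis_mult of_nat_diff algebra_simps)
    finally show ?thesis .
  qed

  have EU: "E t \<le> U t" if t: "t \<in> {0..2*pi}" for t
  proof -
    have "E t = (pi - t) * Im (\<Sum>l\<in>L. F l t * G l t)"
      unfolding FG E_def Im_sum sum_distrib_left by (intro sum.cong refl) auto
    also have "\<dots> \<le> \<bar>pi - t\<bar> * \<bar>Im (\<Sum>l\<in>L. F l t * G l t)\<bar>"
      unfolding abs_mult[symmetric] by (rule abs_ge_self)
    also have "\<dots> \<le> \<bar>pi - t\<bar> * cmod (\<Sum>l\<in>L. F l t * G l t)"
      by (intro mult_left_mono abs_Im_le_cmod abs_ge_zero)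
    also have "\<dots> \<le> pi * (\<Sum>l\<in>L. cmod (F l t) * cmod (G l t))"
      using t by (intro mult_mono sum_norm_le) (auto simp: norm_mult)
    \<comment> \<open>Bounding the product by squares before integrating replaces the Cauchy-Schwarz inequality for
      integrals.\<close>
    also have "\<dots> \<le> pi * (\<Sum>l\<in>L. (r * (cmod (F l t))\<^sup>2 + (cmod (G l t))\<^sup>2 / r) / 2)"
    proof (intro mult_left_mono sum_mono)
      fix l
      have "0 \<le> (r * cmod (F l t) - cmod (G l t))\<^sup>2 / r" using r by simp
      also have "\<dots> = r * (cmod (F l t))\<^sup>2 + (cmod (G l t))\<^sup>2 / r - 2 * (cmod (F l t) * cmod (G l t))"
        using r by (simp add: field_simps power2_eq_square)
      finally show "cmod (F l t) * cmod (G l t) \<le> (r * (cmod (F l t))\<^sup>2 + (cmod (G l t))\<^sup>2 / r) / 2"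
        by simp
    qed simp
    also have "\<dots> = U t"
      by (simp add: U_def sum_divide_distrib[symmetric])
    finally show ?thesis .
  qed

  have "(E has_integral (\<Sum>i<n. \<Sum>j<n. if i < j then 2 * pi / real (j - i) else 0)) {0..2*pi}"
    unfolding E_def
  proof (intro has_integral_sum)
    fix i j
    show "((\<lambda>t. if i < j then (pi - t) * sin (real (j - i) * t) else 0) has_integral
        (if i < j then 2 * pi / real (j - i) else 0)) {0..2 * pi}"
      using has_integral_sawtooth_sin[of "j - i"] by (cases "i < j") auto
  qed auto
  moreover have "(\<Sum>i<n. \<Sum>j<n. if i < j then 2 * pi / real (j - i) else 0)
      = 2 * pi * (\<Sum>i<n. \<Sum>j<n. if i < j then 1 / real (j - i) else 0)"
    unfolding sum_distrib_left by (intro sum.cong refl) auto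
  ultimately have intE: "(E has_integral 2 * pi * (real n * harm n - real n)) {0..2*pi}"
    by (simp add: sum_inverse_differences)

  have intU: "(U has_integral pi / 2 * (\<Sum>l\<in>L. r * (2 * pi * (\<Sum>i<n. (cmod (b i l))\<^sup>2))
      + 2 * pi * (\<Sum>j<n. (cmod (s j l))\<^sup>2) / r)) {0..2*pi}"
    unfolding U_def F_def G_def using \<open>finite L\<close>
    by (intro has_integral_mult_right has_integral_sum has_integral_add has_integral_divide
        has_integral_norm_power2_trig_poly) (auto simp: inj_on_def)

  have "2 * pi * (real n * harm n - real n) \<le> pi / 2 * (\<Sum>l\<in>L. r * (2 * pi * (\<Sum>i<n. (cmod (b i l))\<^sup>2))
      + 2 * pi * (\<Sum>j<n. (cmod (s j l))\<^sup>2) / r)"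
    using intE intU EU by (rule has_integral_le)
  also have "\<dots> = pi\<^sup>2 * (r * (\<Sum>i<n. \<Sum>l\<in>L. (cmod (b i l))\<^sup>2) + (\<Sum>j<n. \<Sum>l\<in>L. (cmod (s j l))\<^sup>2) / r)"
    unfolding sum.swap[of _ "{..<n}" L] sum.distrib sum_distrib_left[symmetric]
      sum_divide_distrib[symmetric] by (simp add: field_simps power2_eq_square)
  also have "\<dots> \<le> pi\<^sup>2 * (r * (\<Sum>i<n. \<beta>\<^sup>2) + (\<Sum>j<n. \<sigma>\<^sup>2) / r)"
    using r b s by (intro mult_left_mono add_mono divide_right_mono sum_mono) auto
  also have "\<dots> = 2 * pi * real n * (pi * \<beta> * \<sigma>)"
    using assms by (simp add: r_def field_simps power2_eq_square)
  finally have "2 * pi * real n * harm n \<le> 2 * pi * real n * (1 + pi * \<beta> * \<sigma>)"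
    by (simp add: algebra_simps)
  then show ?thesis
    using \<open>n > 0\<close> by simp
qed

lemma l2_norm_vec_nonneg: "0 \<le> l2_norm_vec v"
  by (simp add: l2_norm_vec_def)

lemma l2_norm_vec_power2: "(l2_norm_vec v)\<^sup>2 = (\<Sum>l<dim_vec v. (cmod (v $ l))\<^sup>2)"
  by (simp add: l2_norm_vec_def L2_set_def sum_nonneg)

lemma cmod_scalar_prod_le:
  assumes "dim_vec v = dim_vec w"
  shows "cmod (v \<bullet> w) \<le> l2_norm_vec v * l2_norm_vec w"
proof -
  have "cmod (v \<bullet> w) \<le> (\<Sum>l<dim_vec w. cmod (v $ l) * cmod (w $ l))"
    unfolding scalar_prod_def lessThan_atLeast0 by (rule sum_norm_le) (simp add: norm_mult)
  also have "\<dots> \<le> l2_norm_vec v * l2_norm_vec w"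
    using L2_set_mult_ineq[of "\<lambda>l. cmod (v $ l)" "\<lambda>l. cmod (w $ l)"] assms
    by (simp add: l2_norm_vec_def)
  finally show ?thesis .
qed

text \<open>Partial summation turns the identity matrix \<open>B * A\<close> into the
  triangular matrix, with ones on the diagonal because the \<open>k\<close>-th partial sum includes column
  \<open>k\<close>.\<close>

lemma row_mult_col_partial_sum:
  fixes A B :: "'a::comm_ring_1 mat"
  assumes A: "A \<in> carrier_mat n n" and B: "B \<in> carrier_mat n n" and BA: "B * A = 1\<^sub>m n"
    and i: "i < n" and k: "k < n"
  shows "Matrix.row B i \<bullet> finsum_vec TYPE('a) n (Matrix.col A) {..k} = (if i \<le> k then 1 else 0)"
proof -
  have dim: "dim_vec (finsum_vec TYPE('a) n (Matrix.col A) {..k}) = n"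
    using A finsum_vec_closed[of "Matrix.col A" "{..k}" n] by (auto simp: Pi_def)
  have "Matrix.row B i \<bullet> finsum_vec TYPE('a) n (Matrix.col A) {..k} = (\<Sum>l<n. Matrix.row B i $ l * (\<Sum>j\<le>k. Matrix.col A j $ l))"
    using A dim by (auto simp: scalar_prod_def lessThan_atLeast0 index_finsum_vec intro!: sum.cong)
  also have "\<dots> = (\<Sum>j\<le>k. Matrix.row B i \<bullet> Matrix.col A j)"
    using A by (simp add: scalar_prod_def sum_distrib_left lessThan_atLeast0[symmetric])
      (rule sum.swap)
  also have "\<dots> = (\<Sum>j\<le>k. (B * A) $$ (i, j))"
    using A B i k by (intro sum.cong refl) auto
  also have "\<dots> = (\<Sum>j\<le>k. if i = j then 1 else 0)"
    using i k unfolding BA by (intro sum.cong refl) auto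
  also have "\<dots> = (if i \<le> k then 1 else 0)"
    by simp
  finally show ?thesis .
qed

theorem mainTheorem4:
  shows "\<exists>c::real. c > 0 \<and>
    (\<forall>n::nat. \<forall>A::complex mat. n \<ge> 1 \<longrightarrow> A \<in> carrier_mat n n \<longrightarrow> invertible_mat A \<longrightarrow>
      ln (real n) \<le> c
        * Max ((\<lambda>k. l2_norm_vec (Matrix.row (the (mat_inverse A)) k)) ` {..<n})
        * Max ((\<lambda>k. l2_norm_vec (finsum_vec TYPE(complex) n (Matrix.col A) {..k})) ` {..<n}))"
proof (intro exI[of _ "1 + pi"] conjI allI impI)
  show "0 < 1 + pi" by (simp add: add_pos_pos)
next
  fix n :: nat and A :: "complex mat"
  assume n: "n \<ge> 1" and A: "A \<in> carrier_mat n n" and inv: "invertible_mat A"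
  define B where "B = the (mat_inverse A)"
  define S where "S = (\<lambda>k. finsum_vec TYPE(complex) n (Matrix.col A) {..k})"
  define \<beta> where "\<beta> = Max ((\<lambda>k. l2_norm_vec (Matrix.row B k)) ` {..<n})"
  define \<sigma> where "\<sigma> = Max ((\<lambda>k. l2_norm_vec (S k)) ` {..<n})"
  have B: "B \<in> carrier_mat n n" and BA: "B * A = 1\<^sub>m n"
    using the_mat_inverse[OF A inv] A by (auto simp: B_def inverts_mat_def)
  have dim: "dim_col B = n" "dim_vec (S k) = n" for k
    using A B finsum_vec_closed[of "Matrix.col A" "{..k}" n] by (auto simp: S_def Pi_def)
  have prod: "Matrix.row B i \<bullet> S k = (if i \<le> k then 1 else 0)" if "i < n" "k < n" for i k
    unfolding S_def using A B BA that by (rule row_mult_col_partial_sum)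
  have le: "l2_norm_vec (Matrix.row B k) \<le> \<beta>" "l2_norm_vec (S k) \<le> \<sigma>" if "k < n" for k
    using that by (auto simp: \<beta>_def \<sigma>_def)
  have nonneg: "0 \<le> \<beta>" "0 \<le> \<sigma>"
    using le[of 0] n l2_norm_vec_nonneg[of "Matrix.row B 0"] l2_norm_vec_nonneg[of "S 0"] by auto
  have "1 = cmod (Matrix.row B 0 \<bullet> S 0)" using prod[of 0 0] n by simp
  also have "\<dots> \<le> l2_norm_vec (Matrix.row B 0) * l2_norm_vec (S 0)"
    by (rule cmod_scalar_prod_le) (simp add: dim)
  also have "\<dots> \<le> \<beta> * \<sigma>"
    using le[of 0] n nonneg by (intro mult_mono l2_norm_vec_nonneg) auto
  finally have one: "1 \<le> \<beta> * \<sigma>" .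
  then have pos: "0 < \<beta>" "0 < \<sigma>"
    using nonneg by (auto simp: less_le)
  have "harm n \<le> 1 + pi * \<beta> * \<sigma>"
  proof (rule harm_le_of_triangular_factorization[where L = "{..<n}"
        and b = "\<lambda>i l. Matrix.row B i $ l" and s = "\<lambda>j l. S j $ l"])
    fix i j assume "i < n" "j < n"
    then show "(\<Sum>l<n. Matrix.row B i $ l * S j $ l) = (if i \<le> j then 1 else 0)"
      using prod[of i j] by (simp add: scalar_prod_def dim lessThan_atLeast0)
  next
    fix i assume "i < n"
    from power_mono[OF le(1)[OF this] l2_norm_vec_nonneg, of 2]
    show "(\<Sum>l<n. (cmod (Matrix.row B i $ l))\<^sup>2) \<le> \<beta>\<^sup>2"
      by (simp add: l2_norm_vec_power2 dim)
  next
    fix j assume "j < n"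
    from power_mono[OF le(2)[OF this] l2_norm_vec_nonneg, of 2]
    show "(\<Sum>l<n. (cmod (S j $ l))\<^sup>2) \<le> \<sigma>\<^sup>2"
      by (simp add: l2_norm_vec_power2 dim)
  qed (use n pos in auto)
  moreover have "ln (real n) \<le> harm n"
  proof -
    have "ln (real n) \<le> ln (real n + 1)" using n by simp
    also have "\<dots> \<le> harm n" by (rule ln_le_harm)
    finally show ?thesis .
  qed
  ultimately have "ln (real n) \<le> (1 + pi) * \<beta> * \<sigma>"
    using one by (simp add: algebra_simps)
  then show "ln (real n) \<le> (1 + pi)
        * Max ((\<lambda>k. l2_norm_vec (Matrix.row (the (mat_inverse A)) k)) ` {..<n})
        * Max ((\<lambda>k. l2_norm_vec (finsum_vec TYPE(complex) n (Matrix.col A) {..k})) ` {..<n})"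
    by (simp add: \<beta>_def \<sigma>_def B_def S_def)
qed

end
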